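(* Let $k \ge 1$ and let $r \in \mathcal{R}_n = \mathcal{R}_n(a_1,\dots,a_n)$, where $|a_j|>1$ for $1\le j\le n$, be such that $r$ has exactly $n$ poles at $a_1, a_2, \ldots, a_n$, all zeros of $r$ lie in $\{z\in\mathbb{C} : |z|\ge k\}$, and at least one zero of $r$ lies on $\{z : |z|=k\}$. Let $t$ be the number of zeros of $r$ counted with multiplicity. Then for every $z\in\mathbb{C}$ with $|z|=1$, $$|r'(z)| \leq \frac{1}{2}\left[|B'(z)| - \frac{n(1+k)-2t}{1+k}\cdot\frac{|r(z)|^2}{\|r\|^2}\right]\|r\|.$$ Moreover, equality holds for $r(z) = \dfrac{(z+k)^t}{(z-a)^n}$ and $B(z) = \left(\dfrac{1-az}{z-a}\right)^n$ (i.e. $a_1=\dots=a_n=a$) evaluated at $z=1$, where $a>1$, $k\ge 1$.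
   Context: For complex numbers $a_1,\dots,a_n$ (not necessarily distinct) with $|a_j|>1$ for all $j$, put $w(z)=\prod_{j=1}^n (z-a_j)$ and $B(z)=\prod_{j=1}^n \dfrac{1-\overline{a_j}z}{z-a_j}$. Let $\mathcal{P}_n$ be the set of complex polynomials of degree at most $n$, and $\mathcal{R}_n=\mathcal{R}_n(a_1,\dots,a_n)=\{p(z)/w(z) : p\in\mathcal{P}_n\}$. "$r$ has exactly $n$ poles at $a_1,\dots,a_n$" means that, writing $r=p/w$, no cancellation occurs between $p$ and $w$ (poles counted with multiplicity); the zeros of $r$ are its zeros in $\mathbb{C}$, i.e. those of $p$. $\|r\|=\sup_{|z|=1}|r(z)|$. *)

theory Defs
  imports "HOL-Analysis.Analysis" "HOL-Computational_Algebra.Computational_Algebra"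
begin

definition pole_poly :: "nat \<Rightarrow> (nat \<Rightarrow> complex) \<Rightarrow> complex poly" where
  "pole_poly n a = (\<Prod>j=1..n. [:- a j, 1:])"

definition blaschke :: "nat \<Rightarrow> (nat \<Rightarrow> complex) \<Rightarrow> complex \<Rightarrow> complex" where
  "blaschke n a z = (\<Prod>j=1..n. (1 - cnj (a j) * z) / (z - a j))"

text \<open>
  The space \<open>R\<^sub>n(a\<^sub>1,\<dots>,a\<^sub>n)\<close> consists of the functions \<open>rational_fun n a p\<close> with
  \<open>degree p \<le> n\<close>. Since \<open>x / 0 = 0\<close>, such a function takes the value 0 at its poles, so
  the zeros of the rational function are to be read off the numerator \<open>p\<close>.
\<close>

definition rational_fun :: "nat \<Rightarrow> (nat \<Rightarrow> complex) \<Rightarrow> complex poly \<Rightarrow> complex \<Rightarrow> complex" where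
  "rational_fun n a p z = poly p z / poly (pole_poly n a) z"

definition circle_norm :: "(complex \<Rightarrow> complex) \<Rightarrow> real" where
  "circle_norm f = (SUP z\<in>{z. cmod z = 1}. cmod (f z))"

end

theory Submission
  imports Defs "HOL-Complex_Analysis.Conformal_Mappings"
begin

text \<open>
  On the unit circle \<open>Re (z / (z - b)) \<le> 1 / (1 + k)\<close> whenever \<open>\<bar>b\<bar> \<ge> k \<ge> 1\<close>, so the location of
  the zeros bounds \<open>Re (z r'(z) / r(z))\<close> from above by
  \<open>t / (1 + k) - n / 2 + \<bar>B'(z)\<bar> / 2\<close>. Expanding \<open>\<bar>\<bar>B'\<bar> r - z r'\<bar>\<^sup>2\<close>, this becomes a lower bound for
  the derivative of the conjugate transpose \<open>r\<^sup>*\<close> in terms of \<open>\<bar>r'\<bar>\<close> and \<open>\<bar>r\<bar>\<close>. The same bound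
  with \<open>k = 1\<close>, applied to \<open>r + \<mu>\<close> for constants \<open>\<bar>\<mu>\<bar> > \<parallel>r\<parallel>\<close>, yields
  \<open>\<bar>r'\<bar> + \<bar>(r\<^sup>*)'\<bar> \<le> \<bar>B'\<bar> \<parallel>r\<parallel>\<close>; eliminating \<open>\<bar>(r\<^sup>*)'\<bar>\<close> between the two gives the inequality.
\<close>

section \<open>Contribution of the zeros to the logarithmic derivative\<close>

lemma Re_unit_div_diff:
  fixes z b :: complex
  assumes "cmod z = 1" "z \<noteq> b"
  shows "Re (z / (z - b)) = 1 / 2 - ((cmod b)\<^sup>2 - 1) / (2 * (cmod (z - b))\<^sup>2)"
proof -
  have z: "(Re z)\<^sup>2 + (Im z)\<^sup>2 = 1"
    using assms(1) by (simp add: cmod_def)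
  have pos: "(cmod (z - b))\<^sup>2 \<noteq> 0"
    using assms(2) by simp
  have "Re (z / (z - b)) = (Re z * (Re z - Re b) + Im z * (Im z - Im b)) / (cmod (z - b))\<^sup>2"
    by (simp add: Re_divide')
  also have "Re z * (Re z - Re b) + Im z * (Im z - Im b)
      = ((cmod (z - b))\<^sup>2 - ((cmod b)\<^sup>2 - 1)) / 2"
    using z unfolding cmod_power2 by (simp add: power2_eq_square algebra_simps)
  also have "\<dots> / (cmod (z - b))\<^sup>2
      = 1 / 2 - ((cmod b)\<^sup>2 - 1) / (2 * (cmod (z - b))\<^sup>2)"
    using pos by (simp add: field_simps)
  finally show ?thesis .
qed

text \<open>Since \<open>cmod (z - b)\<close> is at most \<open>1 + cmod b\<close>, the exact
  formula is largest when \<open>b\<close> lies diametrically opposite to \<open>z\<close>, where it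
  equals \<open>1 / (1 + cmod b)\<close>; this decreases in \<open>cmod b\<close>.\<close>

lemma Re_unit_div_diff_le:
  fixes z b :: complex
  assumes z: "cmod z = 1" "z \<noteq> b" and k: "1 \<le> k" "k \<le> cmod b"
  shows "Re (z / (z - b)) \<le> 1 / (1 + k)"
proof -
  define m where "m = cmod b"
  have m: "1 \<le> m" "k \<le> m" using k by (auto simp: m_def)
  have "cmod (z - b) \<le> 1 + m"
    using norm_triangle_ineq4[of z b] z by (simp add: m_def)
  then have "(cmod (z - b))\<^sup>2 \<le> (1 + m)\<^sup>2"
    by (intro power_mono) auto
  then have "(m\<^sup>2 - 1) / (2 * (1 + m)\<^sup>2) \<le> (m\<^sup>2 - 1) / (2 * (cmod (z - b))\<^sup>2)"
    using m z by (intro divide_left_mono) auto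
  then have "Re (z / (z - b)) \<le> 1 / 2 - (m\<^sup>2 - 1) / (2 * (1 + m)\<^sup>2)"
    using Re_unit_div_diff[OF z] by (simp add: m_def)
  also have "m\<^sup>2 - 1 = (m - 1) * (1 + m)"
    by (simp add: power2_eq_square algebra_simps)
  also have "1 / 2 - (m - 1) * (1 + m) / (2 * (1 + m)\<^sup>2) = 1 / (1 + m)"
    using m by (simp add: power2_eq_square divide_simps)
  also have "\<dots> \<le> 1 / (1 + k)"
    using m k by (intro divide_left_mono) auto
  finally show ?thesis .
qed

text \<open>The logarithmic derivative is the sum of \<open>1 / (z - b)\<close> over the zeros with
  multiplicity. Splitting off one linear factor at a time, each zero contributes at most
  \<open>1 / (1 + k)\<close>.\<close>

lemma Re_logderiv_poly_le:
  fixes p :: "complex poly"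
  assumes "cmod z = 1" "1 \<le> k"
  shows "poly p z \<noteq> 0 \<Longrightarrow> (\<And>b. poly p b = 0 \<Longrightarrow> k \<le> cmod b) \<Longrightarrow>
    Re (z * poly (pderiv p) z / poly p z) \<le> real (degree p) / (1 + k)"
proof (induction "degree p" arbitrary: p)
  case 0
  then have "pderiv p = 0" by (simp add: pderiv_eq_0_iff)
  then show ?case using 0 by simp
next
  case (Suc d)
  have "\<not> constant (poly p)"
    using Suc.hyps(2) by (simp add: constant_degree)
  then obtain b where b: "poly p b = 0"
    using Fundamental_Theorem_Algebra.fundamental_theorem_of_algebra by metis
  then obtain q where q: "p = [:- b, 1:] * q"
    by (auto simp: poly_eq_0_iff_dvd)
  have "q \<noteq> 0" using q Suc.hyps(2) by auto
  then have "degree p = Suc (degree q)"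
    unfolding q by (subst degree_mult_eq) auto
  then have deg: "d = degree q" using Suc.hyps(2) by simp
  have nz: "poly q z \<noteq> 0" "z \<noteq> b"
    using Suc.prems(1) by (auto simp: q)
  have IH: "Re (z * poly (pderiv q) z / poly q z) \<le> real d / (1 + k)"
    using Suc.hyps(1)[OF deg nz(1)] Suc.prems(2) deg by (simp add: q)
  have "poly (pderiv p) z = poly q z + (z - b) * poly (pderiv q) z" "poly p z = (z - b) * poly q z"
    unfolding q pderiv_mult by (simp_all add: pderiv_pCons algebra_simps)
  then have "z * poly (pderiv p) z / poly p z = z / (z - b) + z * poly (pderiv q) z / poly q z"
    using nz by (simp add: distrib_left add_divide_distrib)
  moreover have "Re (z / (z - b)) \<le> 1 / (1 + k)"
    using Re_unit_div_diff_le[OF assms(1) nz(2) assms(2)] Suc.prems(2)[OF b] .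
  ultimately have "Re (z * poly (pderiv p) z / poly p z) \<le> 1 / (1 + k) + real d / (1 + k)"
    using IH by simp
  also have "\<dots> = real (Suc d) / (1 + k)" by (simp add: add_divide_distrib)
  finally show ?case using Suc.hyps(2) by simp
qed

section \<open>The Blaschke product and the contribution of the poles\<close>

lemma poly_pole_poly: "poly (pole_poly n a) z = (\<Prod>j=1..n. z - a j)"
  by (simp add: pole_poly_def poly_prod)

text \<open>On the unit circle \<open>z B'(z) / B(z)\<close> is positive, so \<open>\<bar>B'(z)\<bar>\<close> is a plain sum.\<close>

lemma cmod_deriv_blaschke:
  assumes a: "\<forall>j\<in>{1..n}. cmod (a j) > 1" and z: "cmod z = 1"
  shows "cmod (deriv (blaschke n a) z)
    = (\<Sum>j=1..n. ((cmod (a j))\<^sup>2 - 1) / (cmod (z - a j))\<^sup>2)"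
proof -
  let ?f = "\<lambda>j u. (1 - cnj (a j) * u) / (u - a j)"
  let ?s = "\<lambda>j. ((cmod (a j))\<^sup>2 - 1) / (cmod (z - a j))\<^sup>2"
  have zz: "z * cnj z = 1"
    using z by (simp add: complex_norm_square[symmetric])
  have nz: "z - a j \<noteq> 0" if "j \<in> {1..n}" for j
    using a that z by force
  \<comment> \<open>Writing 1 as \<open>z * cnj z\<close> shows that each Blaschke factor is a
    number of modulus 1, and it turns the logarithmic derivative of the factor into
    \<open>cnj z\<close> times a positive real.\<close>
  have conj_eq: "1 - cnj (a j) * z = z * cnj (z - a j)" for j
    using zz by (simp add: algebra_simps)
  have nz': "?f j z \<noteq> 0" if "j \<in> {1..n}" for j
    unfolding conj_eq using nz[OF that] z by auto
  have d: "(?f j has_field_derivative of_real ((cmod (a j))\<^sup>2 - 1) / (z - a j)\<^sup>2) (at z)"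
    if "j \<in> {1..n}" for j
  proof -
    have "(?f j has_field_derivative
        ((- cnj (a j)) * (z - a j) - (1 - cnj (a j) * z)) / ((z - a j) * (z - a j))) (at z)"
      using nz[OF that] by (auto intro!: derivative_eq_intros)
    moreover have "(- cnj (a j)) * (z - a j) - (1 - cnj (a j) * z) = of_real ((cmod (a j))\<^sup>2 - 1)"
      unfolding of_real_diff complex_norm_square by (simp add: algebra_simps)
    ultimately show ?thesis by (simp only: power2_eq_square[of "z - a j"])
  qed
  have "deriv (blaschke n a) z = blaschke n a z *
      (\<Sum>j=1..n. (of_real ((cmod (a j))\<^sup>2 - 1) / (z - a j)\<^sup>2) / ?f j z)"
    unfolding blaschke_def
    by (intro DERIV_imp_deriv has_field_derivative_prod' d nz')
  also have "(\<Sum>j=1..n. (of_real ((cmod (a j))\<^sup>2 - 1) / (z - a j)\<^sup>2) / ?f j z)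
      = (\<Sum>j=1..n. cnj z * of_real (?s j))"
  proof (intro sum.cong refl)
    fix j assume j: "j \<in> {1..n}"
    have "(of_real ((cmod (a j))\<^sup>2 - 1) / (z - a j)\<^sup>2) / ?f j z
        = of_real ((cmod (a j))\<^sup>2 - 1) / ((z - a j) * (z * cnj (z - a j)))"
      unfolding conj_eq using nz[OF j] by (simp add: power2_eq_square)
    also have "\<dots> = (1 / z) * (of_real ((cmod (a j))\<^sup>2 - 1) / ((z - a j) * cnj (z - a j)))"
      by simp
    also have "1 / z = cnj z"
      using zz z by (metis nonzero_divide_eq_eq mult.commute mult_zero_left zero_neq_one)
    also have "(z - a j) * cnj (z - a j) = of_real ((cmod (z - a j))\<^sup>2)"
      by (simp only: complex_norm_square)
    finally show "(of_real ((cmod (a j))\<^sup>2 - 1) / (z - a j)\<^sup>2) / ?f j z = cnj z * of_real (?s j)"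
      by simp
  qed
  also have "\<dots> = cnj z * of_real (\<Sum>j=1..n. ?s j)"
    by (simp add: sum_distrib_left)
  finally have "cmod (deriv (blaschke n a) z) = cmod (blaschke n a z) * \<bar>\<Sum>j=1..n. ?s j\<bar>"
    using z by (simp add: norm_mult del: of_real_sum)
  moreover have "cmod (blaschke n a z) = 1"
    unfolding blaschke_def prod_norm[symmetric] conj_eq
  proof (intro prod.neutral ballI)
    fix j assume "j \<in> {1..n}"
    then show "cmod (z * cnj (z - a j) / (z - a j)) = 1"
      using nz z by (simp add: norm_mult norm_divide del: complex_cnj_diff)
  qed
  moreover have "0 \<le> (\<Sum>j=1..n. ?s j)"
  proof (intro sum_nonneg divide_nonneg_nonneg)
    fix j assume "j \<in> {1..n}"
    then show "0 \<le> (cmod (a j))\<^sup>2 - 1" using a by (simp add: less_imp_le)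
  qed simp
  ultimately show ?thesis by simp
qed

lemma cmod_deriv_blaschke_pos:
  assumes a: "\<forall>j\<in>{1..n}. cmod (a j) > 1" and z: "cmod z = 1" and n: "n > 0"
  shows "cmod (deriv (blaschke n a) z) > 0"
  unfolding cmod_deriv_blaschke[OF a z]
proof (intro sum_pos divide_pos_pos)
  fix j assume j: "j \<in> {1..n}"
  then show "0 < (cmod (a j))\<^sup>2 - 1" using a by simp
  have "z \<noteq> a j" using a z j by force
  then show "0 < (cmod (z - a j))\<^sup>2" by simp
qed (use n in auto)

text \<open>Each pole contributes one half minus half of its summand in the formula for the modulus
  of B', so the total involves the poles only through \<open>n\<close> and that modulus.\<close>

lemma Re_logderiv_pole_poly:
  assumes a: "\<forall>j\<in>{1..n}. cmod (a j) > 1" and z: "cmod z = 1"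
  shows "Re (z * poly (pderiv (pole_poly n a)) z / poly (pole_poly n a) z)
    = (real n - cmod (deriv (blaschke n a) z)) / 2"
proof -
  have nz: "z \<noteq> a j" if "j \<in> {1..n}" for j
    using a that z by force
  have "((\<lambda>u. \<Prod>j=1..n. u - a j) has_field_derivative
      (\<Prod>j=1..n. z - a j) * (\<Sum>j=1..n. 1 / (z - a j))) (at z)"
    using nz by (intro has_field_derivative_prod') (auto intro!: derivative_eq_intros)
  then have "poly (pderiv (pole_poly n a)) z
      = poly (pole_poly n a) z * (\<Sum>j=1..n. 1 / (z - a j))"
    using DERIV_unique[OF poly_DERIV[of "pole_poly n a" z]] by (simp add: poly_pole_poly)
  moreover have "poly (pole_poly n a) z \<noteq> 0"
    using nz by (auto simp: poly_pole_poly)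
  ultimately have "z * poly (pderiv (pole_poly n a)) z / poly (pole_poly n a) z
      = z * (\<Sum>j=1..n. 1 / (z - a j))"
    by simp
  also have "\<dots> = (\<Sum>j=1..n. z / (z - a j))"
    by (simp add: sum_distrib_left)
  finally have "z * poly (pderiv (pole_poly n a)) z / poly (pole_poly n a) z
      = (\<Sum>j=1..n. z / (z - a j))" .
  then have "Re (z * poly (pderiv (pole_poly n a)) z / poly (pole_poly n a) z)
      = (\<Sum>j=1..n. Re (z / (z - a j)))"
    by simp
  also have "\<dots> = (\<Sum>j=1..n. 1 / 2 - ((cmod (a j))\<^sup>2 - 1) / (cmod (z - a j))\<^sup>2 / 2)"
    using nz by (intro sum.cong refl) (simp add: Re_unit_div_diff[OF z])
  also have "\<dots> = (real n - cmod (deriv (blaschke n a) z)) / 2"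
    unfolding cmod_deriv_blaschke[OF a z] sum_subtractf sum_divide_distrib[symmetric]
    by (simp add: field_simps)
  finally show ?thesis .
qed

section \<open>Rational functions and their conjugate transpose on the circle\<close>

lemma poly_pole_poly_nonzero:
  assumes "\<forall>j\<in>{1..n}. cmod (a j) > 1" "cmod z \<le> 1"
  shows "poly (pole_poly n a) z \<noteq> 0"
  using assms by (force simp: poly_pole_poly)

lemma deriv_rational_fun:
  assumes "poly (pole_poly n a) z \<noteq> 0"
  shows "deriv (rational_fun n a p) z
    = (poly (pderiv p) z * poly (pole_poly n a) z - poly p z * poly (pderiv (pole_poly n a)) z)
      / (poly (pole_poly n a) z)\<^sup>2"
  unfolding rational_fun_def power2_eq_square
  by (intro DERIV_imp_deriv DERIV_divide poly_DERIV assms)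

text \<open>
  Multiplying the bound on \<open>Re (z r'(z) / r(z))\<close> by \<open>\<bar>r(z)\<bar>\<^sup>2\<close> keeps it meaningful at
  zeros of \<open>r\<close> on the circle.
\<close>

lemma Re_deriv_rational_fun_le:
  assumes a: "\<forall>j\<in>{1..n}. cmod (a j) > 1" and z: "cmod z = 1" and k: "1 \<le> k"
    and zeros: "\<And>b. poly p b = 0 \<Longrightarrow> k \<le> cmod b"
  shows "Re (z * deriv (rational_fun n a p) z * cnj (rational_fun n a p z))
    \<le> (real (degree p) / (1 + k) - (real n - cmod (deriv (blaschke n a) z)) / 2)
      * (cmod (rational_fun n a p z))\<^sup>2"
proof (cases "poly p z = 0")
  case True
  then show ?thesis by (simp add: rational_fun_def)
next
  case False
  let ?w = "pole_poly n a" and ?r = "rational_fun n a p"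
  have w: "poly ?w z \<noteq> 0"
    using poly_pole_poly_nonzero[OF a] z by simp
  let ?L = "z * poly (pderiv p) z / poly p z - z * poly (pderiv ?w) z / poly ?w z"
  have "z * deriv ?r z = ?L * ?r z"
    unfolding deriv_rational_fun[OF w] using w False
    by (simp add: rational_fun_def field_simps power2_eq_square)
  then have "z * deriv ?r z * cnj (?r z) = ?L * of_real ((cmod (?r z))\<^sup>2)"
    by (simp only: complex_norm_square mult.assoc)
  then have "Re (z * deriv ?r z * cnj (?r z)) = Re ?L * (cmod (?r z))\<^sup>2"
    by (simp del: of_real_power)
  also have "\<dots> \<le> (real (degree p) / (1 + k) - (real n - cmod (deriv (blaschke n a) z)) / 2)
      * (cmod (?r z))\<^sup>2"
    using Re_logderiv_poly_le[OF z k False zeros] Re_logderiv_pole_poly[OF a z]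
    by (intro mult_right_mono) (simp_all only: minus_complex.sel diff_right_mono zero_le_power2)
  finally show ?thesis .
qed

text \<open>
  For \<open>\<bar>z\<bar> = 1\<close> the number \<open>\<bar>B'(z)\<bar> r(z) - z r'(z)\<close> has the modulus of the derivative of the
  conjugate transpose \<open>r\<^sup>*(z) = B(z) cnj (r (1 / cnj z))\<close>.
\<close>

lemma cmod_conj_transpose_ge:
  assumes a: "\<forall>j\<in>{1..n}. cmod (a j) > 1" and z: "cmod z = 1" and k: "1 \<le> k"
    and zeros: "\<And>b. poly p b = 0 \<Longrightarrow> k \<le> cmod b"
  defines "\<beta> \<equiv> cmod (deriv (blaschke n a) z)" and "r \<equiv> rational_fun n a p"
  shows "(cmod (deriv r z))\<^sup>2 + \<beta> * (real n - 2 * real (degree p) / (1 + k)) * (cmod (r z))\<^sup>2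
    \<le> (cmod (of_real \<beta> * r z - z * deriv r z))\<^sup>2"
proof -
  let ?x = "z * deriv r z"
  \<comment> \<open>The square is expanded because the upper bound on the mixed term contains
    \<open>\<beta>\<close> itself: once inserted, it cancels the term with the square of
    \<open>\<beta>\<close>.\<close>
  have "(cmod (of_real \<beta> * r z - ?x))\<^sup>2
      = (cmod ?x)\<^sup>2 - 2 * \<beta> * Re (?x * cnj (r z)) + \<beta>\<^sup>2 * (cmod (r z))\<^sup>2"
    unfolding cmod_power2 by (simp add: power2_eq_square algebra_simps)
  moreover have "Re (?x * cnj (r z))
      \<le> (real (degree p) / (1 + k) - (real n - \<beta>) / 2) * (cmod (r z))\<^sup>2"
    unfolding r_def \<beta>_def by (rule Re_deriv_rational_fun_le[OF a z k zeros])
  then have "2 * \<beta> * Re (?x * cnj (r z))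
      \<le> 2 * \<beta> * ((real (degree p) / (1 + k) - (real n - \<beta>) / 2) * (cmod (r z))\<^sup>2)"
    by (intro mult_left_mono) (auto simp: \<beta>_def)
  moreover have "cmod ?x = cmod (deriv r z)"
    using z by (simp add: norm_mult)
  ultimately show ?thesis
    by (simp add: power2_eq_square algebra_simps diff_divide_distrib)
qed

section \<open>Maximum modulus, constant shifts and the main estimate\<close>

lemma cmod_le_circle_norm:
  assumes f: "continuous_on (cball 0 1) f" "f holomorphic_on ball 0 1" and z: "cmod z \<le> 1"
  shows "cmod (f z) \<le> circle_norm f"
proof -
  have S: "{z. cmod z = 1} = sphere (0::complex) 1" by auto
  have "continuous_on (sphere 0 1) (\<lambda>z. cmod (f z))"
    by (intro continuous_on_norm continuous_on_subset[OF f(1)]) auto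
  then have "bdd_above ((\<lambda>z. cmod (f z)) ` sphere 0 1)"
    by (intro bounded_imp_bdd_above compact_imp_bounded compact_continuous_image) auto
  then have "cmod (f u) \<le> circle_norm f" if "cmod u = 1" for u
    unfolding circle_norm_def S using that by (intro cSUP_upper) auto
  then show ?thesis
    using maximum_modulus_frontier[of f "cball 0 1" "circle_norm f" z] f z by simp
qed

text \<open>All poles lie outside the closed disc, so the maximum modulus principle applies. The
  bound inside the disc is what excludes zeros of the shifted function there.\<close>

lemma cmod_rational_fun_le_circle_norm:
  assumes a: "\<forall>j\<in>{1..n}. cmod (a j) > 1" and z: "cmod z \<le> 1"
  shows "cmod (rational_fun n a p z) \<le> circle_norm (rational_fun n a p)"
proof (rule cmod_le_circle_norm[OF _ _ z])
  show "continuous_on (cball 0 1) (rational_fun n a p)"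
    unfolding rational_fun_def using poly_pole_poly_nonzero[OF a]
    by (intro continuous_intros) auto
  show "rational_fun n a p holomorphic_on ball 0 1"
    unfolding rational_fun_def using poly_pole_poly_nonzero[OF a]
    by (intro holomorphic_intros) auto
qed

text \<open>
  Adding a constant \<open>\<mu>\<close> with \<open>\<bar>\<mu>\<bar> > \<parallel>r\<parallel>\<close> to \<open>r\<close> does not change \<open>r'\<close> but moves all zeros out of the
  closed unit disc, so the comparison with the conjugate transpose applies to \<open>r + \<mu>\<close>.
\<close>

lemma cmod_deriv_le_shifted:
  assumes a: "\<forall>j\<in>{1..n}. cmod (a j) > 1" and z: "cmod z = 1" and deg: "degree p \<le> n"
  defines "\<beta> \<equiv> cmod (deriv (blaschke n a) z)" and "r \<equiv> rational_fun n a p"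
  assumes \<mu>: "circle_norm r < cmod \<mu>"
  shows "cmod (deriv r z) \<le> cmod (of_real \<beta> * r z - z * deriv r z + \<mu> * of_real \<beta>)"
proof -
  let ?w = "pole_poly n a"
  define F where "F = p + smult \<mu> ?w"
  let ?R = "rational_fun n a F"
  have R: "?R u = r u + \<mu>" if "cmod u \<le> 1" for u
    using poly_pole_poly_nonzero[OF a that]
    by (simp add: F_def r_def rational_fun_def add_divide_distrib)
  have w: "poly ?w z \<noteq> 0"
    using poly_pole_poly_nonzero[OF a] z by simp
  have R': "deriv ?R z = deriv r z"
    unfolding r_def deriv_rational_fun[OF w]
    by (simp add: F_def pderiv_add pderiv_smult algebra_simps)
  have zeros: "1 \<le> cmod b" if "poly F b = 0" for b
  proof (rule ccontr)
    assume "\<not> 1 \<le> cmod b"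
    then have b: "cmod b \<le> 1" by simp
    have "?R b = 0" using that by (simp add: rational_fun_def)
    then have "r b = - \<mu>" using R[OF b] by (simp add: add_eq_0_iff)
    then show False
      using cmod_rational_fun_le_circle_norm[OF a b, of p] \<mu> by (simp add: r_def)
  qed
  have "degree ?w = n"
    unfolding pole_poly_def by (subst degree_prod_eq_sum_degree) auto
  then have "degree F \<le> n"
    unfolding F_def using deg by (intro degree_add_le) (auto intro: order.trans[OF degree_smult_le])
  then have "0 \<le> \<beta> * (real n - 2 * real (degree F) / (1 + 1)) * (cmod (?R z))\<^sup>2"
    by (simp add: \<beta>_def)
  then have "(cmod (deriv ?R z))\<^sup>2 \<le> (cmod (of_real \<beta> * ?R z - z * deriv ?R z))\<^sup>2"
    using cmod_conj_transpose_ge[OF a z order.refl zeros, of F] unfolding \<beta>_def by linarith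
  then have "cmod (deriv ?R z) \<le> cmod (of_real \<beta> * ?R z - z * deriv ?R z)"
    by (rule power2_le_imp_le) simp
  then show ?thesis
    using R[of z] z by (simp add: R' algebra_simps)
qed

text \<open>The shift \<mu> is free apart from its modulus. Pointing it against \<open>s\<close>
  makes the right side of the shifted inequality as small as possible, and its modulus then tends to
  the norm.\<close>

lemma cmod_deriv_add_conj_transpose_le:
  assumes a: "\<forall>j\<in>{1..n}. cmod (a j) > 1" and z: "cmod z = 1" and deg: "degree p \<le> n"
    and n: "n > 0"
  defines "\<beta> \<equiv> cmod (deriv (blaschke n a) z)" and "r \<equiv> rational_fun n a p"
  shows "cmod (deriv r z) + cmod (of_real \<beta> * r z - z * deriv r z) \<le> \<beta> * circle_norm r"
proof -
  define s where "s = of_real \<beta> * r z - z * deriv r z"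
  define M where "M = circle_norm r"
  have \<beta>: "\<beta> > 0"
    unfolding \<beta>_def by (rule cmod_deriv_blaschke_pos[OF a z n])
  have le: "cmod (deriv r z) \<le> cmod (s + \<mu> * of_real \<beta>)" if "M < cmod \<mu>" for \<mu>
    using cmod_deriv_le_shifted[OF a z deg] that unfolding s_def M_def r_def \<beta>_def by blast
  have rM: "cmod (r z) \<le> M"
    unfolding M_def r_def using cmod_rational_fun_le_circle_norm[OF a] z by simp
  have M0: "0 \<le> M" using rM norm_ge_zero order.trans by blast
  \<comment> \<open>Otherwise \<open>- s / of_real \<beta>\<close> is an admissible shift that makes
    the right side vanish. Then the derivative is 0, and \<open>s\<close> reduces to
    \<open>of_real \<beta> * r z\<close>, which is too small.\<close>
  have s: "cmod s \<le> \<beta> * M"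
  proof (rule ccontr)
    assume *: "\<not> cmod s \<le> \<beta> * M"
    then have "M < cmod (- s / of_real \<beta>)"
      using \<beta> by (simp add: norm_divide field_simps)
    from le[OF this] have "deriv r z = 0" using \<beta> by simp
    then have "cmod s = \<beta> * cmod (r z)" using \<beta> by (simp add: s_def norm_mult)
    then show False using * rM \<beta> by simp
  qed
  have "cmod (deriv r z) + cmod s \<le> \<beta> * M'" if M': "M < M'" for M'
  proof -
    \<comment> \<open>The direction of \<open>s\<close>; the value 1 for \<open>s = 0\<close> keeps
      the modulus equal to 1.\<close>
    define \<sigma> where "\<sigma> = (if s = 0 then 1 else sgn s)"
    have \<sigma>: "cmod \<sigma> = 1" "s = of_real (cmod s) * \<sigma>"
      by (auto simp: \<sigma>_def sgn_div_norm scaleR_conv_of_real norm_mult norm_inverse)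
    have "cmod (- of_real M' * \<sigma>) = M'"
      using \<sigma>(1) M0 M' by (simp add: norm_mult)
    then have "cmod (deriv r z) \<le> cmod (s + (- of_real M' * \<sigma>) * of_real \<beta>)"
      using M' by (intro le) simp
    also have "s + (- of_real M' * \<sigma>) * of_real \<beta> = of_real (cmod s - \<beta> * M') * \<sigma>"
      by (subst \<sigma>(2)) (simp add: algebra_simps)
    also have "cmod \<dots> = \<bar>cmod s - \<beta> * M'\<bar>"
      using \<sigma>(1) by (simp only: norm_mult norm_of_real mult_1_right)
    also have "\<dots> = \<beta> * M' - cmod s"
      using s M' \<beta> by (smt (verit) mult_left_mono)
    finally show ?thesis by simp
  qed
  then have "(cmod (deriv r z) + cmod s) / \<beta> \<le> M'" if "M < M'" for M'
    using that \<beta> by (simp add: field_simps)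
  then have "(cmod (deriv r z) + cmod s) / \<beta> \<le> M"
    by (rule dense_ge)
  then show ?thesis using \<beta> by (simp add: s_def M_def field_simps)
qed

text \<open>From \<open>s \<le> \<beta> * M - d\<close> and the lower bound for the square of
  \<open>s\<close>, the square of \<open>d\<close> cancels and a factor \<open>\<beta>\<close> can
  be divided out, leaving an inequality linear in \<open>d\<close>.\<close>

lemma cmod_deriv_rational_fun_le:
  assumes a: "\<forall>j\<in>{1..n}. cmod (a j) > 1" and z: "cmod z = 1" and k: "1 \<le> k"
    and deg: "degree p \<le> n" and n: "n > 0"
    and zeros: "\<And>b. poly p b = 0 \<Longrightarrow> k \<le> cmod b"
  defines "r \<equiv> rational_fun n a p"
  shows "cmod (deriv r z) \<le> 1 / 2 * (cmod (deriv (blaschke n a) z)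
    - (real n * (1 + k) - 2 * real (degree p)) / (1 + k)
      * ((cmod (r z))\<^sup>2 / (circle_norm r)\<^sup>2)) * circle_norm r"
proof -
  define \<beta> where "\<beta> = cmod (deriv (blaschke n a) z)"
  define M where "M = circle_norm r"
  define d where "d = cmod (deriv r z)"
  define s where "s = cmod (of_real \<beta> * r z - z * deriv r z)"
  define c where "c = real n - 2 * real (degree p) / (1 + k)"
  have c: "(real n * (1 + k) - 2 * real (degree p)) / (1 + k) = c"
    using k by (simp add: c_def field_simps)
  have nonneg: "0 \<le> d" "0 \<le> s" by (auto simp: d_def s_def)
  have 1: "d + s \<le> \<beta> * M"
    unfolding d_def s_def \<beta>_def M_def r_def
    by (rule cmod_deriv_add_conj_transpose_le[OF a z deg n])
  have 2: "d\<^sup>2 + \<beta> * c * (cmod (r z))\<^sup>2 \<le> s\<^sup>2"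
    unfolding d_def s_def \<beta>_def c_def r_def
    by (rule cmod_conj_transpose_ge[OF a z k zeros])
  have \<beta>: "0 < \<beta>"
    unfolding \<beta>_def by (rule cmod_deriv_blaschke_pos[OF a z n])
  have M0: "0 \<le> M"
    unfolding M_def r_def using cmod_rational_fun_le_circle_norm[OF a, of z p] z
    by (intro order.trans[OF norm_ge_zero]) auto
  show ?thesis
  \<comment> \<open>The linear inequality is divided by \<open>M\<close>. If \<open>M = 0\<close>,
    the sum bound forces \<open>d = 0\<close>, and the right side is 0 because of its last
    factor.\<close>
  proof (cases "M = 0")
    case True
    then have "d = 0" using 1 nonneg by simp
    then show ?thesis using True by (simp add: d_def M_def)
  next
    case False
    then have pos: "0 < \<beta>" "0 < M" using \<beta> M0 by auto
    have "s\<^sup>2 \<le> (\<beta> * M - d)\<^sup>2"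
      using 1 nonneg by (intro power_mono) auto
    then have "\<beta> * (c * (cmod (r z))\<^sup>2) \<le> \<beta> * (\<beta> * M\<^sup>2 - 2 * M * d)"
      using 2 by (simp add: power2_eq_square algebra_simps)
    then have "c * (cmod (r z))\<^sup>2 \<le> \<beta> * M\<^sup>2 - 2 * M * d"
      using pos by simp
    then have "d \<le> (\<beta> * M\<^sup>2 - c * (cmod (r z))\<^sup>2) / (2 * M)"
      using pos by (simp add: field_simps)
    also have "\<dots> = 1 / 2 * (\<beta> - c * ((cmod (r z))\<^sup>2 / M\<^sup>2)) * M"
      using pos by (simp add: field_simps power2_eq_square)
    finally have "d \<le> 1 / 2 * (\<beta> - c * ((cmod (r z))\<^sup>2 / M\<^sup>2)) * M" .
    then show ?thesis
      unfolding c d_def \<beta>_def M_def .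
  qed
qed

section \<open>The case of equality\<close>

lemma circle_norm_eqI:
  assumes "cmod u = 1" "\<And>z. cmod z = 1 \<Longrightarrow> cmod (f z) \<le> cmod (f u)"
  shows "circle_norm f = cmod (f u)"
  unfolding circle_norm_def using assms
  by (intro antisym cSUP_least cSUP_upper2[of _ _ u] bdd_aboveI2[of _ _ "cmod (f u)"]) auto

text \<open>Writing the derivative as the function times its logarithmic derivative avoids the
  exponent \<open>n - 1\<close>, so \<open>n = 0\<close> is covered and \<open>r 1\<close> factors
  out of the quotient rule later.\<close>

lemma DERIV_power_add_const:
  fixes z c :: "'a::real_normed_field"
  assumes "z + c \<noteq> 0"
  shows "((\<lambda>z. (z + c) ^ n) has_field_derivative (z + c) ^ n * (of_nat n / (z + c))) (at z)"
proof -
  have "((\<lambda>z. (z + c) ^ n) has_field_derivative of_nat n * (z + c) ^ (n - 1)) (at z)"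
    by (auto intro!: derivative_eq_intros)
  moreover have "of_nat n * (z + c) ^ (n - 1) = (z + c) ^ n * (of_nat n / (z + c))"
    using assms by (cases n) auto
  ultimately show ?thesis by simp
qed

text \<open>On the circle the numerator is largest and the denominator smallest in modulus at 1, so
  the norm is attained there and the quotient of squares is 1. Both sides then equal
  \<open>m * (t / (1 + k) + n / (a - 1))\<close>.\<close>

lemma deriv_extremal_eq:
  fixes n t :: nat and a k :: real
  assumes a: "a > 1" and k: "k \<ge> 1"
  defines "r \<equiv> \<lambda>z::complex. (z + of_real k) ^ t / (z - of_real a) ^ n"
  shows "cmod (deriv r 1) = 1 / 2 * (cmod (deriv (blaschke n (\<lambda>_. of_real a)) 1)
    - (real n * (1 + k) - 2 * real t) / (1 + k)
      * ((cmod (r 1))\<^sup>2 / (circle_norm r)\<^sup>2)) * circle_norm r"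
proof -
  define m where "m = (1 + k) ^ t / (a - 1) ^ n"
  have m: "m > 0" using a k by (simp add: m_def)
  have ne: "(1::complex) - of_real a \<noteq> 0" "(1::complex) + of_real k \<noteq> 0"
    using a k by (auto simp: complex_eq_iff)
  have n1: "cmod (1 - of_real a) = a - 1" "cmod (1 + of_real k) = 1 + k"
    using a k norm_of_real[of "1 - a", where 'a = complex]
      norm_of_real[of "1 + k", where 'a = complex] by auto
  have r1: "cmod (r 1) = m"
    by (simp add: r_def m_def norm_divide norm_power n1)
  have norm: "circle_norm r = m"
    unfolding r1[symmetric]
  proof (rule circle_norm_eqI)
    fix z :: complex assume z: "cmod z = 1"
    have "cmod (z + of_real k) \<le> 1 + k"
      using norm_triangle_ineq[of z "of_real k"] z k by simp
    moreover have "a - 1 \<le> cmod (z - of_real a)"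
      using norm_triangle_ineq2[of "of_real a" z] z a by (simp add: norm_minus_commute)
    ultimately have "cmod (z + of_real k) ^ t / cmod (z - of_real a) ^ n \<le> m"
      unfolding m_def using a k by (intro frac_le power_mono) auto
    then show "cmod (r z) \<le> cmod (r 1)"
      unfolding r1 by (simp add: r_def norm_divide norm_power)
  qed simp
  have "((\<lambda>z. (z + of_real k) ^ t) has_field_derivative
      (1 + of_real k) ^ t * (of_nat t / (1 + of_real k))) (at (1::complex))"
    using DERIV_power_add_const[OF ne(2)] .
  moreover have "((\<lambda>z. (z - of_real a) ^ n) has_field_derivative
      (1 - of_real a) ^ n * (of_nat n / (1 - of_real a))) (at (1::complex))"
    using DERIV_power_add_const[of 1 "- of_real a" n] ne(1) by simp
  ultimately have D: "(r has_field_derivative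
      ((1 + of_real k) ^ t * (of_nat t / (1 + of_real k)) * (1 - of_real a) ^ n
        - (1 + of_real k) ^ t * ((1 - of_real a) ^ n * (of_nat n / (1 - of_real a))))
        / ((1 - of_real a) ^ n * (1 - of_real a) ^ n)) (at 1)"
    unfolding r_def using ne(1) by (intro DERIV_divide) auto
  have quot: "(u * x * v - u * (v * y)) / (v * v) = u / v * (x - y)" if "v \<noteq> 0"
    for u v x y :: complex
    using that by (simp add: field_simps)
  have "(r has_field_derivative
      r 1 * (of_nat t / (1 + of_real k) - of_nat n / (1 - of_real a))) (at 1)"
    using D unfolding quot[OF power_not_zero[OF ne(1)]] by (simp only: r_def)
  then have "deriv r 1 = r 1 * (of_nat t / (1 + of_real k) - of_nat n / (1 - of_real a))"
    by (rule DERIV_imp_deriv)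
  \<comment> \<open>The sign change exhibits the logarithmic derivative as a sum of two nonnegative
    reals, so its modulus is the sum itself.\<close>
  also have "of_nat n / (1 - of_real a) = - (of_nat n / (of_real a - 1 :: complex))"
    by (metis minus_diff_eq minus_divide_right)
  finally have "deriv r 1 = r 1 * of_real (real t / (1 + k) + real n / (a - 1))"
    by simp
  moreover have "0 \<le> real t / (1 + k) + real n / (a - 1)" using a k by simp
  ultimately have d: "cmod (deriv r 1) = m * (real t / (1 + k) + real n / (a - 1))"
    by (simp only: norm_mult norm_of_real r1 abs_of_nonneg)
  have "cmod (deriv (blaschke n (\<lambda>_. of_real a)) 1) = real n * ((a\<^sup>2 - 1) / (a - 1)\<^sup>2)"
    using a by (subst cmod_deriv_blaschke) (auto simp: n1)
  also have "(a\<^sup>2 - 1) / (a - 1)\<^sup>2 = (a + 1) / (a - 1)"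
    using a by (simp add: power2_eq_square square_diff_one_factored)
  finally have B: "cmod (deriv (blaschke n (\<lambda>_. of_real a)) 1)
      = real n * ((a + 1) / (a - 1))" .
  have pole: "(a + 1) / (a - 1) = 1 + 2 / (a - 1)"
    using a by (simp add: field_simps)
  have zero: "(real n * (1 + k) - 2 * real t) / (1 + k) = real n - 2 * (real t / (1 + k))"
    using k by (simp add: field_simps)
  have one: "m\<^sup>2 / m\<^sup>2 = 1" using m by simp
  show ?thesis
    unfolding d norm r1 B pole zero one by (simp add: ring_distribs ac_simps)
qed

theorem corollary1p2:
  "(\<forall>(n::nat) (a::nat \<Rightarrow> complex) (k::real) (p::complex poly) (r::complex \<Rightarrow> complex) (t::nat).
      k \<ge> 1 \<longrightarrow>
      (\<forall>j\<in>{1..n}. cmod (a j) > 1) \<longrightarrow>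
      degree p \<le> n \<longrightarrow>
      r = rational_fun n a p \<longrightarrow>
      coprime p (pole_poly n a) \<longrightarrow>
      (\<forall>z. poly p z = 0 \<longrightarrow> cmod z \<ge> k) \<longrightarrow>
      (\<exists>z. poly p z = 0 \<and> cmod z = k) \<longrightarrow>
      t = size (proots p) \<longrightarrow>
      (\<forall>z. cmod z = 1 \<longrightarrow>
        cmod (deriv r z) \<le>
          1 / 2 * (cmod (deriv (blaschke n a) z)
                   - (real n * (1 + k) - 2 * real t) / (1 + k)
                     * ((cmod (r z))\<^sup>2 / (circle_norm r)\<^sup>2)) * circle_norm r))
   \<and>
   (\<forall>(n::nat) (t::nat) (a::real) (k::real) (r::complex \<Rightarrow> complex) (B::complex \<Rightarrow> complex).
      a > 1 \<longrightarrow> k \<ge> 1 \<longrightarrow> t \<le> n \<longrightarrow>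
      r = (\<lambda>z. (z + of_real k) ^ t / (z - of_real a) ^ n) \<longrightarrow>
      B = (\<lambda>z. ((1 - of_real a * z) / (z - of_real a)) ^ n) \<longrightarrow>
      B = blaschke n (\<lambda>_. of_real a) \<and>
      r = rational_fun n (\<lambda>_. of_real a) ([:of_real k, 1:] ^ t) \<and>
      cmod (deriv r 1) =
        1 / 2 * (cmod (deriv B 1)
                 - (real n * (1 + k) - 2 * real t) / (1 + k)
                   * ((cmod (r 1))\<^sup>2 / (circle_norm r)\<^sup>2)) * circle_norm r)"
proof (intro conjI allI impI)
  fix n :: nat and a :: "nat \<Rightarrow> complex" and k :: real and p :: "complex poly"
    and r :: "complex \<Rightarrow> complex" and t :: nat and z :: complex
  assume k: "k \<ge> 1" and a: "\<forall>j\<in>{1..n}. cmod (a j) > 1" and deg: "degree p \<le> n"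
    and r: "r = rational_fun n a p" and zeros: "\<forall>z. poly p z = 0 \<longrightarrow> cmod z \<ge> k"
    and ex: "\<exists>z. poly p z = 0 \<and> cmod z = k" and t: "t = size (proots p)" and z: "cmod z = 1"
  \<comment> \<open>For \<open>n = 0\<close> the numerator would be a constant with a zero, hence
    vanish at 0 too, although all zeros have modulus at least 1. Positivity of \<open>n\<close>
    makes B' nonzero on the circle.\<close>
  have "n > 0"
  proof (rule ccontr)
    assume "\<not> n > 0"
    then obtain c where c: "p = [:c:]" using deg degree_eq_zeroE by auto
    then have "poly p 0 = 0" using ex by auto
    then show False using zeros k by force
  qed
  then show "cmod (deriv r z) \<le> 1 / 2 * (cmod (deriv (blaschke n a) z)
      - (real n * (1 + k) - 2 * real t) / (1 + k)
        * ((cmod (r z))\<^sup>2 / (circle_norm r)\<^sup>2)) * circle_norm r"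
    unfolding r t size_proots_complex using zeros
    by (intro cmod_deriv_rational_fun_le[OF a z k deg]) auto
next
  fix n t :: nat and a k :: real and r B :: "complex \<Rightarrow> complex"
  assume a: "a > 1" and k: "k \<ge> 1"
    and r: "r = (\<lambda>z. (z + of_real k) ^ t / (z - of_real a) ^ n)"
    and B: "B = (\<lambda>z. ((1 - of_real a * z) / (z - of_real a)) ^ n)"
  show B': "B = blaschke n (\<lambda>_. of_real a)"
    by (simp add: B blaschke_def fun_eq_iff)
  show "r = rational_fun n (\<lambda>_. of_real a) ([:of_real k, 1:] ^ t)"
    by (simp add: r rational_fun_def poly_pole_poly fun_eq_iff add.commute)
  show "cmod (deriv r 1) = 1 / 2 * (cmod (deriv B 1)
      - (real n * (1 + k) - 2 * real t) / (1 + k)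
        * ((cmod (r 1))\<^sup>2 / (circle_norm r)\<^sup>2)) * circle_norm r"
    unfolding B' r by (rule deriv_extremal_eq[OF a k])
qed

end
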